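(* Let $\beta\ge 1$ and $f(t)=t^\beta$. For any two jobs $i,j$: if $i\prec_\ell j$, then $i\prec_g j$.
   Context: Let $f(t)=t^\beta$ for $t\ge 0$. A job $k$ has a processing time $p_k>0$ and a weight $w_k>0$. An instance is a finite set of jobs; a schedule is an ordering of all jobs of the instance, processed consecutively without idle time from time $0$ on a single machine; the completion time $C_k$ of job $k$ is the sum of the processing times of $k$ and of all jobs preceding it; the cost of a schedule $S$ is $F(S)=\sum_k w_k f(C_k)$, and a schedule is optimal if it minimizes $F$. Standing assumption: within an instance no two jobs have the same processing time, the same weight, or the same ratio $w_k/p_k$. Local order: $i\prec_\ell j$ means that for every $t\ge 0$, $w_j\big(f(t+p_i+p_j)-f(t+p_j)\big) < w_i\big(f(t+p_i+p_j)-f(t+p_i)\big)$. Global order: $i\prec_g j$ means that for every instance containing $i$ and $j$ (together with arbitrary other jobs), every optimal schedule processes $i$ before $j$. *)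

theory Defs
  imports Complex_Main "HOL-Combinatorics.Multiset_Permutations"
begin

text \<open>A job is identified with its pair of parameters. This loses nothing, because two jobs of the
  same instance never share a processing time.\<close>

datatype job = Job (ptime: real) (weight: real)

definition valid_job :: "job \<Rightarrow> bool" where
  "valid_job k \<longleftrightarrow> ptime k > 0 \<and> weight k > 0"

definition valid_instance :: "job set \<Rightarrow> bool" where
  "valid_instance I \<longleftrightarrow> finite I \<and> (\<forall>k\<in>I. valid_job k) \<and>
     inj_on ptime I \<and> inj_on weight I \<and> inj_on (\<lambda>k. weight k / ptime k) I"

text \<open>The schedules of an instance \<open>I\<close> are the lists in \<open>permutations_of_set I\<close>, read in processing
  order. The cost function \<open>f\<close> is a parameter of all definitions that depend on it.\<close>

definition before :: "job list \<Rightarrow> job \<Rightarrow> job \<Rightarrow> bool" where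
  "before S i j \<longleftrightarrow> (\<exists>m n. m < n \<and> n < length S \<and> S ! m = i \<and> S ! n = j)"

definition completion_time :: "job list \<Rightarrow> job \<Rightarrow> real" where
  "completion_time S k = ptime k + (\<Sum>l | l \<in> set S \<and> before S l k. ptime l)"

definition cost :: "(real \<Rightarrow> real) \<Rightarrow> job list \<Rightarrow> real" where
  "cost f S = (\<Sum>k\<in>set S. weight k * f (completion_time S k))"

definition optimal_schedule :: "(real \<Rightarrow> real) \<Rightarrow> job set \<Rightarrow> job list \<Rightarrow> bool" where
  "optimal_schedule f I S \<longleftrightarrow> S \<in> permutations_of_set I \<and>
     (\<forall>S'\<in>permutations_of_set I. cost f S \<le> cost f S')"

definition local_order :: "(real \<Rightarrow> real) \<Rightarrow> job \<Rightarrow> job \<Rightarrow> bool" where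
  "local_order f i j \<longleftrightarrow> (\<forall>t\<ge>0.
     weight j * (f (t + ptime i + ptime j) - f (t + ptime j))
       < weight i * (f (t + ptime i + ptime j) - f (t + ptime i)))"

definition global_order :: "(real \<Rightarrow> real) \<Rightarrow> job \<Rightarrow> job \<Rightarrow> bool" where
  "global_order f i j \<longleftrightarrow> (\<forall>I S. valid_instance I \<longrightarrow> i \<in> I \<longrightarrow> j \<in> I \<longrightarrow>
     optimal_schedule f I S \<longrightarrow> before S i j)"

end

theory Submission imports Defs "HOL-Real_Asymp.Real_Asymp"
begin

text \<open>Suppose that an optimal schedule processes \<open>j\<close> before \<open>i\<close>, as in \<open>A j B i C\<close>, let \<open>a\<close> be the total
  processing time of \<open>A\<close>, and write \<open>\<Delta>\<^sub>p(x) = f(x + p) - f(x)\<close>.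

  If \<open>p\<^sub>i < p\<^sub>j\<close>, compare with \<open>A i j B C\<close> and \<open>A i B j C\<close>. The ratio of
  \<open>f(x + p\<^sub>i + p\<^sub>j) - f(x + p\<^sub>j)\<close> to \<open>f(x + p\<^sub>j) - f(x + p\<^sub>i)\<close> is nonincreasing in \<open>x\<close>, so
  its value at \<open>a\<close> relates the delay of \<open>B\<close> in the former schedule to its gain in the latter. The two
  optimality inequalities then contradict the local order at \<open>t = a\<close>.

  If \<open>p\<^sub>i > p\<^sub>j\<close>, the local order for \<open>t \<rightarrow> \<infinity>\<close> and the distinctness of the ratios yield
  \<open>w\<^sub>i / p\<^sub>i > w\<^sub>j / p\<^sub>j\<close>. Compare with all schedules \<open>A B\<^sub>1 i B\<^sub>2 j C\<close> where
  \<open>B = B\<^sub>1 B\<^sub>2\<close>. The ratio \<open>N(x) = \<Delta>\<^bsub>p\<^sub>j\<^esub>(x) / \<Delta>\<^bsub>p\<^sub>i\<^esub>(x)\<close> is nondecreasing with values in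
  \<open>(0, 1)\<close>, so its increments are the coefficients of a convex combination of these comparisons; the
  coefficients are chosen such that the weights of \<open>B\<close> cancel. What remains is false by
  convexity of \<open>f\<close> and monotonicity of \<open>p \<mapsto> p f'(x + p) / \<Delta>\<^sub>p(x)\<close>.\<close>

section \<open>Inequalities for powers\<close>

lemma powr_affine_comb_mono:
  fixes \<beta> a b :: real
  assumes "\<beta> > 0" "a \<le> b" and nonneg: "\<And>x. x \<in> {a..b} \<Longrightarrow> p + q * x \<ge> 0 \<and> r + s * x \<ge> 0"
    and pos: "\<And>x. x \<in> {a<..<b} \<Longrightarrow> p + q * x > 0 \<and> r + s * x > 0"
    and deriv: "\<And>x. x \<in> {a<..<b} \<Longrightarrow>
      d * s * (r + s * x) powr (\<beta> - 1) \<le> c * q * (p + q * x) powr (\<beta> - 1)"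
  shows "c * (p + q * a) powr \<beta> - d * (r + s * a) powr \<beta>
       \<le> c * (p + q * b) powr \<beta> - d * (r + s * b) powr \<beta>"
proof (rule DERIV_nonneg_imp_increasing_open[OF \<open>a \<le> b\<close>])
  fix x assume "a < x" "x < b"
  then have x: "x \<in> {a<..<b}" by simp
  let ?D = "\<beta> * (c * q * (p + q * x) powr (\<beta> - 1) - d * s * (r + s * x) powr (\<beta> - 1))"
  have "((\<lambda>x. c * (p + q * x) powr \<beta> - d * (r + s * x) powr \<beta>) has_real_derivative ?D) (at x)"
    using pos[OF x] by (auto intro!: derivative_eq_intros simp: algebra_simps)
  moreover have "?D \<ge> 0" using deriv[OF x] \<open>\<beta> > 0\<close> by simp
  ultimately show "\<exists>y. ((\<lambda>x. c * (p + q * x) powr \<beta> - d * (r + s * x) powr \<beta>)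
      has_real_derivative y) (at x) \<and> y \<ge> 0" by blast
next
  show "continuous_on {a..b} (\<lambda>x. c * (p + q * x) powr \<beta> - d * (r + s * x) powr \<beta>)"
    using nonneg \<open>\<beta> > 0\<close> by (intro continuous_intros continuous_on_powr') auto
qed

text \<open>The derivatives of \<open>(x + d) powr \<beta>\<close> and \<open>x powr \<beta>\<close>
  have the quotient \<open>((x + d) / x) powr (\<beta> - 1)\<close>, which is nonincreasing in
  \<open>x\<close>. Its value at \<open>s\<close> therefore bounds the quotient of the increments
  from above on \<open>[s, t]\<close> and from below on \<open>[r, s]\<close>.\<close>

lemma powr_increment_ratio_shift:
  fixes \<beta> d r s t :: real
  assumes \<beta>: "\<beta> \<ge> 1" and "d \<ge> 0" "0 \<le> r" "r < s" "s \<le> t"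
  shows "((t + d) powr \<beta> - (s + d) powr \<beta>) * (s powr \<beta> - r powr \<beta>)
       \<le> (t powr \<beta> - s powr \<beta>) * ((s + d) powr \<beta> - (r + d) powr \<beta>)"
proof -
  \<comment> \<open>The quotient of the two derivatives at the common endpoint
    \<open>s\<close>.\<close>
  define \<rho> where "\<rho> = ((s + d) / s) powr (\<beta> - 1)"
  have \<rho>: "\<rho> * x powr (\<beta> - 1) = (x * (s + d) / s) powr (\<beta> - 1)" if "x > 0" for x
    using that assms unfolding \<rho>_def by (subst powr_mult[symmetric]) (auto simp: field_simps)
  have "\<rho> * (0 + 1 * s) powr \<beta> - 1 * (d + 1 * s) powr \<beta>
      \<le> \<rho> * (0 + 1 * t) powr \<beta> - 1 * (d + 1 * t) powr \<beta>"
  proof (rule powr_affine_comb_mono)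
    fix x assume x: "x \<in> {s<..<t}"
    have "d + x \<le> x * (s + d) / s" using x assms mult_right_mono[of s x d]
      by (auto simp: field_simps)
    then show "1 * 1 * (d + 1 * x) powr (\<beta> - 1) \<le> \<rho> * 1 * (0 + 1 * x) powr (\<beta> - 1)"
      using x assms \<rho>[of x] by (auto intro!: powr_mono2)
  qed (use assms in auto)
  then have 1: "(t + d) powr \<beta> - (s + d) powr \<beta> \<le> \<rho> * (t powr \<beta> - s powr \<beta>)"
    by (simp add: algebra_simps)
  have "1 * (d + 1 * r) powr \<beta> - \<rho> * (0 + 1 * r) powr \<beta>
      \<le> 1 * (d + 1 * s) powr \<beta> - \<rho> * (0 + 1 * s) powr \<beta>"
  proof (rule powr_affine_comb_mono)
    fix x assume x: "x \<in> {r<..<s}"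
    have "x * (s + d) / s \<le> d + x" using x assms mult_right_mono[of x s d]
      by (auto simp: field_simps)
    then show "\<rho> * 1 * (0 + 1 * x) powr (\<beta> - 1) \<le> 1 * 1 * (d + 1 * x) powr (\<beta> - 1)"
      using x assms \<rho>[of x] by (auto intro!: powr_mono2)
  qed (use assms in auto)
  then have 2: "\<rho> * (s powr \<beta> - r powr \<beta>) \<le> (s + d) powr \<beta> - (r + d) powr \<beta>"
    by (simp add: algebra_simps)
  have "r powr \<beta> \<le> s powr \<beta>" "s powr \<beta> \<le> t powr \<beta>"
    using assms by (auto intro!: powr_mono2)
  then show ?thesis
    using mult_right_mono[OF 1, of "s powr \<beta> - r powr \<beta>"]
      mult_left_mono[OF 2, of "t powr \<beta> - s powr \<beta>"]
    by (simp add: algebra_simps)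
qed

text \<open>With \<open>p\<close> and \<open>q\<close> the processing times of \<open>j\<close> and
  \<open>i\<close>, this is the function N of the overview.\<close>

definition increment_ratio :: "real \<Rightarrow> real \<Rightarrow> real \<Rightarrow> real \<Rightarrow> real" where
  "increment_ratio \<beta> p q x = ((x + p) powr \<beta> - x powr \<beta>) / ((x + q) powr \<beta> - x powr \<beta>)"

lemma powr_increment_pos: "(x + p) powr \<beta> - x powr \<beta> > 0" if "\<beta> \<ge> 1" "x \<ge> 0" "p > 0"
  for \<beta> x p :: real
  using that by (simp add: powr_less_mono2)

lemma increment_ratio_pos: "increment_ratio \<beta> p q x > 0"
  if "\<beta> \<ge> 1" "x \<ge> 0" "p > 0" "q > 0"
  using that powr_increment_pos unfolding increment_ratio_def by simp

lemma increment_ratio_less_1: "increment_ratio \<beta> p q x < 1"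
  if "\<beta> \<ge> 1" "x \<ge> 0" "0 < p" "p < q"
  using that powr_increment_pos[of \<beta> x q] powr_less_mono2[of \<beta> "x + p" "x + q"]
  unfolding increment_ratio_def by simp

text \<open>The reciprocal is 1 plus the quotient of the increments over
  \<open>[x + p, x + q]\<close> and \<open>[x, x + p]\<close>, which a shift to the right does not
  increase.\<close>

lemma increment_ratio_mono:
  assumes "\<beta> \<ge> 1" "0 \<le> x" "x \<le> y" "0 < p" "p \<le> q"
  shows "increment_ratio \<beta> p q x \<le> increment_ratio \<beta> p q y"
  using powr_increment_ratio_shift[of \<beta> "y - x" x "x + p" "x + q"]
    powr_increment_pos[of \<beta> x q] powr_increment_pos[of \<beta> y q] assms
  unfolding increment_ratio_def by (simp add: field_simps)

text \<open>Both increments are integrals over \<open>t\<close> from 0 to 1, with integrands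
  proportional to \<open>p * (x + p * t) powr (\<beta> - 1)\<close> and the same with
  \<open>q\<close>. Cross-multiplied, the integrands compare pointwise in \<open>t\<close>.\<close>

lemma powr_elasticity_le:
  fixes \<beta> x p q :: real
  assumes \<beta>: "\<beta> \<ge> 1" and "x \<ge> 0" "0 < p" "p \<le> q"
  shows "p * (x + p) powr (\<beta> - 1) \<le> increment_ratio \<beta> p q x * (q * (x + q) powr (\<beta> - 1))"
proof -
  let ?P = "p * (x + p) powr (\<beta> - 1)" and ?Q = "q * (x + q) powr (\<beta> - 1)"
  have "?Q * (x + p * 0) powr \<beta> - ?P * (x + q * 0) powr \<beta>
      \<le> ?Q * (x + p * 1) powr \<beta> - ?P * (x + q * 1) powr \<beta>"
  proof (rule powr_affine_comb_mono)
    fix t :: real assume t: "t \<in> {0<..<1}"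
    have "0 \<le> x * (1 - t) * (q - p)" using t assms by simp
    then have "(x + p) * (x + q * t) \<le> (x + q) * (x + p * t)"
      by (simp add: algebra_simps)
    then have "((x + p) * (x + q * t)) powr (\<beta> - 1) \<le> ((x + q) * (x + p * t)) powr (\<beta> - 1)"
      using t assms by (intro powr_mono2) auto
    then have "(x + p) powr (\<beta> - 1) * (x + q * t) powr (\<beta> - 1)
        \<le> (x + q) powr (\<beta> - 1) * (x + p * t) powr (\<beta> - 1)"
      using t assms by (simp add: powr_mult)
    then have "p * q * ((x + p) powr (\<beta> - 1) * (x + q * t) powr (\<beta> - 1))
        \<le> p * q * ((x + q) powr (\<beta> - 1) * (x + p * t) powr (\<beta> - 1))"
      using assms by (intro mult_left_mono) auto
    then show "?P * q * (x + q * t) powr (\<beta> - 1) \<le> ?Q * p * (x + p * t) powr (\<beta> - 1)"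
      by (simp add: mult_ac)
  qed (use assms in \<open>auto intro: add_nonneg_pos\<close>)
  then show ?thesis
    using powr_increment_pos[of \<beta> x q] assms
    by (simp add: increment_ratio_def field_simps)
qed

text \<open>Integrates \<open>powr_elasticity_le\<close> over \<open>[u, v]\<close>, with the
  increasing factor bounded by its value at \<open>v\<close>.\<close>

lemma powr_elasticity_increment_le:
  fixes \<beta> u v p q :: real
  assumes \<beta>: "\<beta> \<ge> 1" and "0 \<le> u" "u \<le> v" "0 < p" "p \<le> q"
  shows "p * ((v + p) powr \<beta> - (u + p) powr \<beta>)
       \<le> increment_ratio \<beta> p q v * (q * ((v + q) powr \<beta> - (u + q) powr \<beta>))"
proof -
  let ?N = "increment_ratio \<beta> p q"
  have "(?N v * q) * (q + 1 * u) powr \<beta> - p * (p + 1 * u) powr \<beta>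
      \<le> (?N v * q) * (q + 1 * v) powr \<beta> - p * (p + 1 * v) powr \<beta>"
  proof (rule powr_affine_comb_mono)
    fix x assume x: "x \<in> {u<..<v}"
    have "p * (x + p) powr (\<beta> - 1) \<le> ?N x * (q * (x + q) powr (\<beta> - 1))"
      using powr_elasticity_le x assms by auto
    also have "\<dots> \<le> ?N v * (q * (x + q) powr (\<beta> - 1))"
      using increment_ratio_mono x assms by (intro mult_right_mono) auto
    finally show "p * 1 * (p + 1 * x) powr (\<beta> - 1)
        \<le> (?N v * q) * 1 * (q + 1 * x) powr (\<beta> - 1)"
      by (simp add: algebra_simps)
  qed (use assms in auto)
  then show ?thesis by (simp add: algebra_simps)
qed

text \<open>Convexity: among chords ending at \<open>x + q + p\<close>, the shorter one is at least
  as steep. Both left ends move linearly away from that point as \<open>t\<close> runs from 0 to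
  1.\<close>

lemma powr_left_slope_le:
  fixes \<beta> x p q :: real
  assumes \<beta>: "\<beta> \<ge> 1" and "x \<ge> 0" "0 < p" "p \<le> q"
  shows "p * ((x + q + p) powr \<beta> - (x + p) powr \<beta>)
       \<le> q * ((x + q + p) powr \<beta> - (x + q) powr \<beta>)"
proof -
  let ?z = "x + q + p"
  have le: "p \<le> ?z - q * t" "q \<le> ?z - p * t" if "t \<le> 1" for t
    using mult_left_mono[OF that, of q] mult_left_mono[OF that, of p] assms by linarith+
  have "p * (?z + (-q) * 0) powr \<beta> - q * (?z + (-p) * 0) powr \<beta>
      \<le> p * (?z + (-q) * 1) powr \<beta> - q * (?z + (-p) * 1) powr \<beta>"
  proof (rule powr_affine_comb_mono)
    show "?z + - q * t \<ge> 0 \<and> ?z + - p * t \<ge> 0" if "t \<in> {0..1}" for t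
    proof -
      from that have "t \<le> 1" by simp
      from le[OF this] assms show ?thesis by (intro conjI) linarith+
    qed
    show "?z + - q * t > 0 \<and> ?z + - p * t > 0" if "t \<in> {0<..<1}" for t
    proof -
      from that have "t \<le> 1" by simp
      from le[OF this] assms show ?thesis by (intro conjI) linarith+
    qed
    fix t :: real assume t: "t \<in> {0<..<1}"
    from t have "t \<le> 1" by simp
    with le[of t] assms have "?z - q * t \<ge> 0" by linarith
    moreover have "p * t \<le> q * t" using t assms by (intro mult_right_mono) auto
    ultimately have "(?z - q * t) powr (\<beta> - 1) \<le> (?z - p * t) powr (\<beta> - 1)"
      using assms by (intro powr_mono2) auto
    then have "p * q * (?z - q * t) powr (\<beta> - 1) \<le> p * q * (?z - p * t) powr (\<beta> - 1)"
      using assms by (intro mult_left_mono) auto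
    then show "q * - p * (?z + - p * t) powr (\<beta> - 1) \<le> p * - q * (?z + - q * t) powr (\<beta> - 1)"
      by (simp add: mult_ac)
  qed (use assms in auto)
  then show ?thesis by (simp add: algebra_simps)
qed

section \<open>Costs of schedules\<close>

lemma before_Cons_hd: "distinct (k # S) \<Longrightarrow> \<not> before (k # S) l k"
  unfolding before_def by (auto simp: nth_Cons' in_set_conv_nth split: if_splits)

lemma before_Cons_tl:
  assumes "distinct (k # S)" "m \<in> set S"
  shows "before (k # S) l m \<longleftrightarrow> l = k \<or> before S l m"
proof
  assume "before (k # S) l m"
  then obtain x y where "x < y" "y < length (k # S)" "(k # S) ! x = l" "(k # S) ! y = m"
    unfolding before_def by blast
  then show "l = k \<or> before S l m"
    unfolding before_def by (cases x; cases y) auto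
next
  assume "l = k \<or> before S l m"
  then show "before (k # S) l m"
  proof
    assume "l = k"
    moreover obtain n where "n < length S" "S ! n = m" using assms by (auto simp: in_set_conv_nth)
    ultimately show ?thesis
      unfolding before_def by (intro exI[of _ 0] exI[of _ "Suc n"]) auto
  next
    assume "before S l m"
    then obtain x y where "x < y" "y < length S" "S ! x = l" "S ! y = m"
      unfolding before_def by blast
    then show ?thesis
      unfolding before_def by (intro exI[of _ "Suc x"] exI[of _ "Suc y"]) auto
  qed
qed

lemma not_before_obtain_split:
  assumes "\<not> before S i j" "i \<in> set S" "j \<in> set S" "i \<noteq> j"
  obtains A B C where "S = A @ j # B @ i # C"
proof -
  obtain X Y where S: "S = X @ j # Y" using \<open>j \<in> set S\<close> by (meson split_list)
  have "i \<notin> set X"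
  proof
    assume "i \<in> set X"
    then obtain n where "n < length X" "X ! n = i" by (auto simp: in_set_conv_nth)
    then have "before S i j"
      unfolding before_def S by (intro exI[of _ n] exI[of _ "length X"]) (auto simp: nth_append)
    with assms show False by blast
  qed
  with assms S have "i \<in> set Y" by auto
  then obtain B C where "Y = B @ i # C" by (meson split_list)
  with S that show ?thesis by simp
qed

lemma completion_time_Cons_hd: "distinct (k # S) \<Longrightarrow> completion_time (k # S) k = ptime k"
  using before_Cons_hd unfolding completion_time_def by auto

lemma completion_time_Cons_tl:
  assumes "distinct (k # S)" "m \<in> set S"
  shows "completion_time (k # S) m = ptime k + completion_time S m"
proof -
  have "{l. l \<in> set (k # S) \<and> before (k # S) l m} = insert k {l. l \<in> set S \<and> before S l m}"
    using before_Cons_tl[OF assms] by auto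
  then show ?thesis using assms unfolding completion_time_def by simp
qed

text \<open>Carrying the start time makes costs split along concatenations, so one block can be
  compared at shifted starts.\<close>

fun cost_from :: "(real \<Rightarrow> real) \<Rightarrow> real \<Rightarrow> job list \<Rightarrow> real" where
  "cost_from f t [] = 0"
| "cost_from f t (k # S) = weight k * f (t + ptime k) + cost_from f (t + ptime k) S"

abbreviation total_ptime :: "job list \<Rightarrow> real" where
  "total_ptime S \<equiv> sum_list (map ptime S)"

lemma total_ptime_nonneg: "(\<And>k. k \<in> set S \<Longrightarrow> valid_job k) \<Longrightarrow> total_ptime S \<ge> 0"
  by (rule sum_list_nonneg) (auto simp: valid_job_def less_imp_le)

lemma cost_from_append:
  "cost_from f t (S @ S') = cost_from f t S + cost_from f (t + total_ptime S) S'"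
  by (induction S arbitrary: t) (auto simp: algebra_simps)

lemma cost_from_conv_sum:
  "distinct S \<Longrightarrow> cost_from f t S = (\<Sum>k\<in>set S. weight k * f (t + completion_time S k))"
proof (induction S arbitrary: t)
  case (Cons k S)
  then have "(\<Sum>m\<in>set S. weight m * f (t + completion_time (k # S) m)) = cost_from f (t + ptime k) S"
    by (auto simp: completion_time_Cons_tl add.assoc intro!: sum.cong)
  with Cons.prems show ?case by (simp add: completion_time_Cons_hd)
qed simp

lemma cost_conv_cost_from: "distinct S \<Longrightarrow> cost f S = cost_from f 0 S"
  by (simp add: cost_def cost_from_conv_sum)

text \<open>Rearranging the middle block preserves its total length, so the costs of
  \<open>A\<close> and \<open>C\<close> cancel.\<close>

lemma optimal_schedule_middle_le:
  assumes "optimal_schedule f I (A @ M @ C)" "mset M' = mset M"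
  shows "cost_from f (total_ptime A) M \<le> cost_from f (total_ptime A) M'"
proof -
  let ?S = "A @ M @ C" and ?S' = "A @ M' @ C"
  have S: "set ?S = I" "distinct ?S"
    using assms(1) unfolding optimal_schedule_def permutations_of_set_def by auto
  have eq: "mset ?S' = mset ?S" using assms(2) by simp
  have S': "set ?S' = I" "distinct ?S'"
    using S mset_eq_setD[OF eq] mset_eq_imp_distinct_iff[OF eq] by auto
  then have "cost f ?S \<le> cost f ?S'"
    using assms(1) unfolding optimal_schedule_def permutations_of_set_def by blast
  moreover have "total_ptime M' = total_ptime M"
    using assms(2) by (metis mset_map sum_mset_sum_list)
  ultimately show ?thesis
    unfolding cost_conv_cost_from[OF S(2)] cost_conv_cost_from[OF S'(2)]
    by (simp add: cost_from_append)
qed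

lemma optimal_schedule_cong:
  assumes "\<And>t. t \<ge> 0 \<Longrightarrow> f t = g t" "valid_instance I" "optimal_schedule f I S"
  shows "optimal_schedule g I S"
proof -
  have "cost f S' = cost g S'" if S': "S' \<in> permutations_of_set I" for S'
  proof -
    have valid: "valid_job k" if "k \<in> set S'" for k
      using that S' assms(2) unfolding valid_instance_def permutations_of_set_def by auto
    then have "completion_time S' k \<ge> 0" if "k \<in> set S'" for k
      using that unfolding completion_time_def
      by (intro add_nonneg_nonneg sum_nonneg) (auto simp: valid_job_def less_imp_le)
    then show ?thesis unfolding cost_def by (intro sum.cong) (auto simp: assms(1))
  qed
  then show ?thesis using assms(3) unfolding optimal_schedule_def by auto
qed

section \<open>Exchange arguments\<close>

text \<open>For each job \<open>k\<close> of \<open>B\<close>,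
  \<open>powr_increment_ratio_shift\<close> applies with the shift \<open>u + ptime k - a\<close>.
  The results are weighted and added; \<open>a\<close> stays fixed while \<open>u\<close> advances
  through \<open>B\<close>.\<close>

lemma cost_from_shift_ratio:
  fixes \<beta> a p q u :: real
  defines "f \<equiv> \<lambda>t. t powr \<beta>"
  assumes "\<beta> \<ge> 1" "0 \<le> a" "a \<le> u" "0 < p" "p < q" and "\<And>k. k \<in> set B \<Longrightarrow> valid_job k"
  shows "(cost_from f (u + p + q) B - cost_from f (u + q) B) * (f (a + q) - f (a + p))
       \<le> (f (a + p + q) - f (a + q)) * (cost_from f (u + q) B - cost_from f (u + p) B)"
  using assms(4,7)
proof (induction B arbitrary: u)
  case (Cons k B)
  define v where "v = u + ptime k"
  have k: "ptime k > 0" "weight k > 0" using Cons.prems by (auto simp: valid_job_def)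
  have "(f (v + p + q) - f (v + q)) * (f (a + q) - f (a + p))
      \<le> (f (a + p + q) - f (a + q)) * (f (v + q) - f (v + p))"
    using powr_increment_ratio_shift[of \<beta> "v - a" "a + p" "a + q" "a + p + q"]
      assms(2-6) Cons.prems(1) k(1)
    unfolding f_def v_def by (simp add: algebra_simps)
  then have "weight k * ((f (v + p + q) - f (v + q)) * (f (a + q) - f (a + p)))
      \<le> weight k * ((f (a + p + q) - f (a + q)) * (f (v + q) - f (v + p)))"
    using k by (intro mult_left_mono) auto
  moreover have
    "(cost_from f (v + p + q) B - cost_from f (v + q) B) * (f (a + q) - f (a + p))
       \<le> (f (a + p + q) - f (a + q)) * (cost_from f (v + q) B - cost_from f (v + p) B)"
    using Cons.prems k by (intro Cons.IH) (auto simp: v_def)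
  moreover have "u + p + q + ptime k = v + p + q" "u + q + ptime k = v + q"
    "u + p + ptime k = v + p" by (auto simp: v_def)
  ultimately show ?case by (simp add: algebra_simps)
qed simp

lemma exchange_shorter_job:
  fixes \<beta> a :: real
  defines "f \<equiv> \<lambda>t. t powr \<beta>"
  assumes "\<beta> \<ge> 1" "0 \<le> a" "valid_job i" "valid_job j" "ptime i < ptime j"
    and B: "\<And>k. k \<in> set B \<Longrightarrow> valid_job k"
    and local: "local_order f i j"
    and opt1: "cost_from f a (j # B @ [i]) \<le> cost_from f a (i # j # B)"
    and opt2: "cost_from f a (j # B @ [i]) \<le> cost_from f a (i # B @ [j])"
  shows False
proof -
  let ?p = "ptime i" and ?q = "ptime j" and ?v = "weight i" and ?w = "weight j"
  define D E H F where "D = f (a + ?p + ?q)" and "E = f (a + ?q)" and "H = f (a + ?p)"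
    and "F = f (a + ?p + ?q + total_ptime B)"
  define G where "G x = cost_from f x B" for x
  have pq: "?p > 0" "?q > 0" using assms(4,5) by (auto simp: valid_job_def)
  have "H < E" "E < D" "D \<le> F" unfolding D_def E_def H_def F_def f_def
    using pq assms(2,3,6) total_ptime_nonneg[OF B]
    by (auto intro!: powr_less_mono2 powr_mono2)
  have eqs: "a + ?q + ?p = a + ?p + ?q" "a + ?q + (total_ptime B + ?p) = a + ?p + ?q + total_ptime B"
    "a + ?p + (total_ptime B + ?q) = a + ?p + ?q + total_ptime B"
    "a + ?q + total_ptime B + ?p = a + ?p + ?q + total_ptime B"
    "a + ?p + total_ptime B + ?q = a + ?p + ?q + total_ptime B" by auto
  \<comment> \<open>Moving \<open>i\<close> to the front delays \<open>B\<close> by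
    \<open>ptime i\<close>.\<close>
  have 1: "?v * (F - H) - ?w * (D - E) \<le> G (a + ?p + ?q) - G (a + ?q)"
    using opt1 by (simp add: cost_from_append eqs D_def E_def H_def F_def G_def algebra_simps)
  \<comment> \<open>Swapping \<open>i\<close> and \<open>j\<close> makes \<open>B\<close> start
    earlier by \<open>ptime j - ptime i\<close>.\<close>
  have 2: "G (a + ?q) - G (a + ?p) \<le> ?w * (F - E) - ?v * (F - H)"
    using opt2 by (simp add: cost_from_append eqs D_def E_def H_def F_def G_def algebra_simps)
  have "(?v * (F - H) - ?w * (D - E)) * (E - H) \<le> (G (a + ?p + ?q) - G (a + ?q)) * (E - H)"
    using 1 \<open>H < E\<close> by (intro mult_right_mono) auto
  also have "\<dots> \<le> (D - E) * (G (a + ?q) - G (a + ?p))"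
    using cost_from_shift_ratio[of \<beta> a a ?p ?q B] assms(2,3,6) pq B
    unfolding G_def D_def E_def H_def f_def by simp
  also have "\<dots> \<le> (D - E) * (?w * (F - E) - ?v * (F - H))"
    using 2 \<open>E < D\<close> by (intro mult_left_mono) auto
  \<comment> \<open>Collecting terms by \<open>(E - H) + (D - E) = D - H\<close> and
    \<open>(F - E) + (E - H) = F - H\<close> produces the common factor
    \<open>F - H\<close>.\<close>
  finally have "?v * (D - H) * (F - H) \<le> ?w * (D - E) * (F - H)"
    by (simp add: algebra_simps)
  then have "?v * (D - H) \<le> ?w * (D - E)"
    using \<open>H < E\<close> \<open>E < D\<close> \<open>D \<le> F\<close> by simp
  moreover have "?w * (D - E) < ?v * (D - H)"
    using local \<open>0 \<le> a\<close> unfolding local_order_def D_def E_def H_def by blast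
  ultimately show False by simp
qed

text \<open>This is the summation by parts over \<open>B\<close> behind the convex combination: the increments of
  \<open>increment_ratio\<close> are its coefficients.\<close>

lemma cost_from_shift_lower_bound:
  fixes \<beta> a :: real and i j :: job and B :: "job list"
  defines "f \<equiv> \<lambda>t. t powr \<beta>"
  defines "N \<equiv> \<lambda>x. increment_ratio \<beta> (ptime j) (ptime i) x"
  defines "gain \<equiv> \<lambda>B1 B2. cost_from f a (j # B @ [i]) - cost_from f a (B1 @ i # B2 @ [j])"
  assumes "\<beta> \<ge> 1" "0 \<le> a" "valid_job i" "valid_job j" "ptime j \<le> ptime i"
    and B: "\<And>k. k \<in> set B \<Longrightarrow> valid_job k"
    and opt: "\<And>B1 B2. B = B1 @ B2 \<Longrightarrow> gain B1 B2 \<le> 0"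
    and "B = B1 @ B2"
  shows "N (a + total_ptime B1) * gain B1 B2
      + weight i * ptime j / ptime i * (f (a + total_ptime B1 + ptime j) - f (a + ptime j))
    \<le> cost_from f (a + ptime j) B1 - cost_from f a B1"
  using assms(11)
proof (induction B1 arbitrary: B2 rule: rev_induct)
  case Nil
  have "N a \<ge> 0" unfolding N_def
    using assms(4-7) unfolding valid_job_def by (blast intro: less_imp_le increment_ratio_pos)
  then have "N a * gain [] B2 \<le> 0" using opt[of "[]" B2] Nil by (simp add: mult_nonneg_nonpos)
  then show ?case by simp
next
  case (snoc k B1)
  let ?p = "ptime j" and ?q = "ptime i"
  define u v g g' where "u = a + total_ptime B1" and "v = u + ptime k"
    and "g = gain B1 (k # B2)" and "g' = gain (B1 @ [k]) B2"
  have pos: "?p > 0" "?q > 0" "weight i > 0" "ptime k > 0"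
    using assms(6,7) B snoc.prems by (auto simp: valid_job_def)
  have "u \<ge> 0" unfolding u_def using assms(5) B snoc.prems total_ptime_nonneg[of B1] by auto
  have IH: "N u * g + weight i * ?p / ?q * (f (u + ?p) - f (a + ?p))
      \<le> cost_from f (a + ?p) B1 - cost_from f a B1"
    using snoc.IH[of "k # B2"] snoc.prems by (simp add: u_def g_def)
  \<comment> \<open>The two compared schedules differ only by interchanging the adjacent jobs
    \<open>i\<close> and \<open>k\<close>.\<close>
  have step: "g' - g = weight k * (f (v + ?q) - f v) - weight i * (f (v + ?q) - f (u + ?q))"
    by (simp add: g_def g'_def gain_def cost_from_append u_def v_def algebra_simps)
  have "weight k * (f (v + ?p) - f v) = N v * (weight k * (f (v + ?q) - f v))"
    unfolding N_def increment_ratio_def f_def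
    using powr_increment_pos[of \<beta> v ?q] assms(4) pos \<open>u \<ge> 0\<close> by (simp add: v_def)
  also have "\<dots> = N v * (g' - g) + N v * (weight i * (f (v + ?q) - f (u + ?q)))"
    by (simp add: step algebra_simps)
  finally have k: "weight k * (f (v + ?p) - f v)
      = N v * (g' - g) + N v * (weight i * (f (v + ?q) - f (u + ?q)))" .
  \<comment> \<open>Optimality enters here: as \<open>g\<close> is nonpositive, passing from
    \<open>N u\<close> to the larger \<open>N v\<close> can only lower the product.\<close>
  have "N u \<le> N v" unfolding N_def
    using increment_ratio_mono assms(4,8) pos \<open>u \<ge> 0\<close> by (simp add: v_def)
  moreover have "g \<le> 0" unfolding g_def using opt snoc.prems by simp
  ultimately have mono: "N v * g \<le> N u * g" by (rule mult_right_mono_neg)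
  \<comment> \<open>Bounds the contribution of \<open>i\<close> by a term whose coefficient does not
    depend on the position in \<open>B\<close>, so that it telescopes.\<close>
  have "?p * (f (v + ?p) - f (u + ?p)) \<le> N v * (?q * (f (v + ?q) - f (u + ?q)))"
    unfolding N_def f_def
    using powr_elasticity_increment_le assms(4,8) pos \<open>u \<ge> 0\<close> by (simp add: v_def)
  then have "weight i / ?q * (?p * (f (v + ?p) - f (u + ?p)))
      \<le> weight i / ?q * (N v * (?q * (f (v + ?q) - f (u + ?q))))"
    using pos by (intro mult_left_mono) auto
  also have "\<dots> = N v * (weight i * (f (v + ?q) - f (u + ?q)))"
    using pos by simp
  finally have elast: "weight i * ?p / ?q * (f (v + ?p) - f (u + ?p))
      \<le> N v * (weight i * (f (v + ?q) - f (u + ?q)))" by simp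
  have "N v * g' + weight i * ?p / ?q * (f (v + ?p) - f (a + ?p))
      = N v * (g' - g) + N v * g + weight i * ?p / ?q * (f (v + ?p) - f (u + ?p))
        + weight i * ?p / ?q * (f (u + ?p) - f (a + ?p))"
    by (simp add: right_diff_distrib)
  also have "\<dots> \<le> cost_from f (a + ?p) B1 - cost_from f a B1 + weight k * (f (v + ?p) - f v)"
    using IH mono elast k by linarith
  also have "\<dots> = cost_from f (a + ?p) (B1 @ [k]) - cost_from f a (B1 @ [k])"
    by (simp add: cost_from_append u_def v_def algebra_simps)
  finally show ?case by (simp add: g'_def u_def v_def add.assoc)
qed

text \<open>Inserting the lower bound for the shift of all of \<open>B\<close> into the formula for
  \<open>g\<close> gives \<open>n * g < g\<close>, impossible for \<open>n < 1\<close> and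
  \<open>g \<le> 0\<close>. The coefficient \<open>?v * ?p / ?q\<close> exceeds \<open>?w\<close> by
  the ratio hypothesis, and convexity handles the last increment.\<close>

lemma exchange_longer_job:
  fixes \<beta> a :: real
  defines "f \<equiv> \<lambda>t. t powr \<beta>"
  assumes "\<beta> \<ge> 1" "0 \<le> a" "valid_job i" "valid_job j" "ptime j < ptime i"
    and B: "\<And>k. k \<in> set B \<Longrightarrow> valid_job k"
    and ratio: "weight j / ptime j < weight i / ptime i"
    and opt: "\<And>B1 B2. B = B1 @ B2 \<Longrightarrow>
      cost_from f a (j # B @ [i]) \<le> cost_from f a (B1 @ i # B2 @ [j])"
  shows False
proof -
  let ?p = "ptime j" and ?q = "ptime i" and ?v = "weight i" and ?w = "weight j"
  define x where "x = a + total_ptime B"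
  define g where "g = cost_from f a (j # B @ [i]) - cost_from f a (B @ i # [] @ [j])"
  define n where "n = increment_ratio \<beta> ?p ?q x"
  have pq: "?p > 0" "?q > 0" "?v > 0" "?w > 0" using assms(4,5) by (auto simp: valid_job_def)
  have "x \<ge> 0" unfolding x_def using total_ptime_nonneg[OF B] assms(3) by simp
  have "?w < ?v * ?p / ?q" using ratio pq by (simp add: field_simps)
  moreover have "f (a + ?p) < f (x + ?q + ?p)"
    unfolding f_def x_def using assms(2,3) pq add_nonneg_pos[OF total_ptime_nonneg[OF B] pq(2)]
    by (intro powr_less_mono2) auto
  ultimately have "?w * (f (x + ?q + ?p) - f (a + ?p))
      < ?v * ?p / ?q * (f (x + ?q + ?p) - f (a + ?p))"
    by (intro mult_strict_right_mono) auto
  moreover have "?v / ?q * (?p * (f (x + ?q + ?p) - f (x + ?p)))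
      \<le> ?v / ?q * (?q * (f (x + ?q + ?p) - f (x + ?q)))"
    unfolding f_def using assms(2,6) pq \<open>x \<ge> 0\<close>
    by (intro mult_left_mono powr_left_slope_le) auto
  then have "?v * ?p / ?q * (f (x + ?q + ?p) - f (x + ?p)) \<le> ?v * (f (x + ?q + ?p) - f (x + ?q))"
    using pq by simp
  moreover have "?v * ?p / ?q * (f (x + ?q + ?p) - f (a + ?p))
      = ?v * ?p / ?q * (f (x + ?q + ?p) - f (x + ?p)) + ?v * ?p / ?q * (f (x + ?p) - f (a + ?p))"
    by (simp only: distrib_left[symmetric]) simp
  moreover have "n * g + ?v * ?p / ?q * (f (x + ?p) - f (a + ?p))
      \<le> cost_from f (a + ?p) B - cost_from f a B"
    using cost_from_shift_lower_bound[of \<beta> a i j B B "[]"] assms(2-6) B opt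
    unfolding n_def g_def x_def f_def by simp
  moreover have "g = cost_from f (a + ?p) B - cost_from f a B
      + ?v * (f (x + ?q + ?p) - f (x + ?q)) - ?w * (f (x + ?q + ?p) - f (a + ?p))"
    by (simp add: g_def cost_from_append x_def algebra_simps)
  ultimately have "n * g < g" by linarith
  moreover have "n < 1"
    unfolding n_def using increment_ratio_less_1 assms(2,6) pq \<open>x \<ge> 0\<close> by blast
  moreover have "g \<le> 0" using opt[of B "[]"] by (simp add: g_def)
  ultimately show False using mult_right_mono_neg[of n 1 g] by linarith
qed

section \<open>Local order and ratios\<close>

text \<open>To leading order each difference is its gap times
  \<open>\<beta> * t powr (\<beta> - 1)\<close>, and this factor cancels.\<close>

lemma powr_increment_quotient_tendsto:
  fixes \<beta> p q r s :: real
  assumes "\<beta> \<ge> 1" "p < q" "r < s"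
  shows "((\<lambda>t. ((t + q) powr \<beta> - (t + p) powr \<beta>) / ((t + s) powr \<beta> - (t + r) powr \<beta>))
    \<longlongrightarrow> (q - p) / (s - r)) at_top"
proof -
  have "(q * \<beta> - p * \<beta>) * inverse (s * \<beta> - r * \<beta>) = (q - p) / (s - r)"
    using assms by (simp add: left_diff_distrib[symmetric] divide_inverse[symmetric])
  with assms show ?thesis by real_asymp
qed

text \<open>Divide the local inequality at \<open>t\<close> by the positive increment and let
  \<open>t\<close> tend to infinity; the limit loses strictness.\<close>

lemma local_order_imp_ratio_le:
  assumes "\<beta> \<ge> 1" "valid_job i" "valid_job j" "local_order (\<lambda>t. t powr \<beta>) i j"
  shows "weight j / ptime j \<le> weight i / ptime i"
proof -
  let ?p = "ptime i" and ?q = "ptime j"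
  have pos: "?p > 0" "?q > 0" "weight i > 0" "weight j > 0"
    using assms(2,3) by (auto simp: valid_job_def)
  have "((\<lambda>t. ((t + (?p + ?q)) powr \<beta> - (t + ?q) powr \<beta>) / ((t + (?p + ?q)) powr \<beta> - (t + ?p) powr \<beta>))
    \<longlongrightarrow> (?p + ?q - ?q) / (?p + ?q - ?p)) at_top"
    by (rule powr_increment_quotient_tendsto) (use assms(1) pos in auto)
  moreover have "\<forall>\<^sub>F t in at_top. ((t + (?p + ?q)) powr \<beta> - (t + ?q) powr \<beta>)
      / ((t + (?p + ?q)) powr \<beta> - (t + ?p) powr \<beta>) \<le> weight i / weight j"
    using eventually_ge_at_top[of "0::real"]
  proof eventually_elim
    case (elim t)
    have "(t + ?p) powr \<beta> < (t + (?p + ?q)) powr \<beta>"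
      using elim pos assms(1) by (intro powr_less_mono2) auto
    moreover have "weight j * ((t + (?p + ?q)) powr \<beta> - (t + ?q) powr \<beta>)
        < weight i * ((t + (?p + ?q)) powr \<beta> - (t + ?p) powr \<beta>)"
      using assms(4) elim unfolding local_order_def by (simp add: add.assoc)
    ultimately show ?case using pos by (simp add: field_simps)
  qed
  ultimately have "(?p + ?q - ?q) / (?p + ?q - ?p) \<le> weight i / weight j"
    by (intro tendsto_upperbound) auto
  then show ?thesis using pos by (simp add: field_simps)
qed

theorem theorem2:
  fixes \<beta> :: real and f :: "real \<Rightarrow> real" and i j :: job
  assumes "\<beta> \<ge> 1"
    and "\<And>t. t \<ge> 0 \<Longrightarrow> f t = t powr \<beta>"
    and "valid_job i" and "valid_job j"
    and "local_order f i j"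
  shows "global_order f i j"
  unfolding global_order_def
proof (intro allI impI, rule ccontr)
  fix I S
  assume inst: "valid_instance I" and ij: "i \<in> I" "j \<in> I" and opt: "optimal_schedule f I S"
    and nb: "\<not> before S i j"
  let ?f = "\<lambda>t. t powr \<beta>"
  have local: "local_order ?f i j"
    using assms(2-5) unfolding local_order_def valid_job_def by simp
  have opt': "optimal_schedule ?f I S" by (rule optimal_schedule_cong[OF assms(2) inst opt])
  \<comment> \<open>For \<open>i = j\<close> both sides of the strict local inequality would
    coincide.\<close>
  have "i \<noteq> j" using assms(5) unfolding local_order_def by auto
  have "set S = I" using opt unfolding optimal_schedule_def permutations_of_set_def by auto
  then obtain A B C where S: "S = A @ j # B @ i # C"
    using not_before_obtain_split[OF nb] ij \<open>i \<noteq> j\<close> by metis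
  define a where "a = total_ptime A"
  have valid: "\<And>k. k \<in> set A \<union> set B \<Longrightarrow> valid_job k"
    using inst \<open>set S = I\<close> S unfolding valid_instance_def by auto
  have "a \<ge> 0" unfolding a_def using valid by (intro total_ptime_nonneg) auto
  have le: "cost_from ?f a (j # B @ [i]) \<le> cost_from ?f a M" if "mset M = mset (j # B @ [i])" for M
    unfolding a_def using optimal_schedule_middle_le[of ?f I A "j # B @ [i]" C M] opt' that
    by (simp add: S)
  have inj: "inj_on ptime I" "inj_on (\<lambda>k. weight k / ptime k) I"
    using inst unfolding valid_instance_def by auto
  consider "ptime i < ptime j" | "ptime j < ptime i"
    using inj_onD[OF inj(1)] ij \<open>i \<noteq> j\<close> by fastforce
  then show False
  proof cases
    case 1
    then show False
      using exchange_shorter_job[of \<beta> a i j B] assms(1,3,4) \<open>a \<ge> 0\<close> valid local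
        le[of "i # j # B"] le[of "i # B @ [j]"] by simp
  next
    case 2
    \<comment> \<open>Distinct ratios restore the strictness lost in the limit.\<close>
    have "weight j / ptime j \<noteq> weight i / ptime i"
      using inj_onD[OF inj(2)] ij \<open>i \<noteq> j\<close> by metis
    then have "weight j / ptime j < weight i / ptime i"
      using local_order_imp_ratio_le[OF assms(1,3,4) local] by simp
    with assms(1,3,4) \<open>a \<ge> 0\<close> valid 2 show False
      by (intro exchange_longer_job[of \<beta> a i j B] le) auto
  qed
qed

end
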